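(* Let $n\geq 3$, let $I_n=\{0,\ldots,n-1\}$, let $a\in I_n$, and let $\mathrm{U}_n\subseteq\{0,1\}^n$ be the set of binary sequences of length $n$ containing exactly one occurrence of $1$. Let $K_a$ be the simplicial complex over $I_n$ whose maximal simplices are the sets $\{a,b,c\}$ with $b,c$ distinct elements of $I_n\setminus\{a\}$. Then $K_a$ is a minimal complex generating $\mathrm{U}_n$.
   Context: All sets are finite (possibly empty). For $f:B^J\to A^I$ write $f_i(x)=f(x)_i$. For $i\in I$, the input window $\mathcal{W}_f(i)$ is the smallest set $W\subseteq J$ (it exists) such that for all $x,y\in B^J$, $x|_W=y|_W$ implies $f_i(x)=f_i(y)$. A simplicial complex (or complex) over $I$ is a collection of subsets of $I$ (its simplices) closed under taking subsets; the empty set is a simplex of every complex. The communication complex $K_f$ of $f$ is the complex over $I$ in which a non-empty $S\subseteq I$ is a simplex iff $\bigcap_{i\in S}\mathcal{W}_f(i)\neq\emptyset$. A complex $K$ over $I$ generates a language $L\subseteq A^I$ if there exist finite sets $B,J$ and a function $f:B^J\to A^I$ with image exactly $L$ and $K_f\subseteq K$. A complex generating $L$ is minimal if no complex strictly contained in it generates $L$. We write $\{0,1\}^n$ for $\{0,1\}^{I_n}$. *)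

theory Defs
  imports Main "HOL-Library.FuncSet"
begin

text \<open>Words in \<open>A\<^sup>I\<close> are the extensional functions \<^term>\<open>I \<rightarrow>\<^sub>E A\<close>. A map
  \<open>f : B\<^sup>J \<rightarrow> A\<^sup>I\<close> is a HOL function of which only the values on \<^term>\<open>J \<rightarrow>\<^sub>E B\<close> matter;
  the coordinate \<open>f\<^sub>i(x)\<close> is \<^term>\<open>f x i\<close>.\<close>

definition determines ::
  "'b set \<Rightarrow> 'j set \<Rightarrow> (('j \<Rightarrow> 'b) \<Rightarrow> ('i \<Rightarrow> 'a)) \<Rightarrow> 'i \<Rightarrow> 'j set \<Rightarrow> bool" where
  "determines B J f i W \<longleftrightarrow> W \<subseteq> J \<and>
    (\<forall>x \<in> J \<rightarrow>\<^sub>E B. \<forall>y \<in> J \<rightarrow>\<^sub>E B. restrict x W = restrict y W \<longrightarrow> f x i = f y i)"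

text \<open>\<^term>\<open>Least\<close> is taken with respect to inclusion; the least set exists for finite \<open>J\<close>
  by \<open>input_window_least\<close> below.\<close>

definition input_window ::
  "'b set \<Rightarrow> 'j set \<Rightarrow> (('j \<Rightarrow> 'b) \<Rightarrow> ('i \<Rightarrow> 'a)) \<Rightarrow> 'i \<Rightarrow> 'j set" where
  "input_window B J f i = (LEAST W. determines B J f i W)"

definition simplicial_complex :: "'i set \<Rightarrow> 'i set set \<Rightarrow> bool" where
  "simplicial_complex I K \<longleftrightarrow>
    K \<subseteq> Pow I \<and> {} \<in> K \<and> (\<forall>S \<in> K. \<forall>T. T \<subseteq> S \<longrightarrow> T \<in> K)"

definition maximal_simplices :: "'i set set \<Rightarrow> 'i set set" where
  "maximal_simplices K = {S \<in> K. \<forall>T \<in> K. S \<subseteq> T \<longrightarrow> T = S}"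

definition communication_complex ::
  "'b set \<Rightarrow> 'j set \<Rightarrow> 'i set \<Rightarrow> (('j \<Rightarrow> 'b) \<Rightarrow> ('i \<Rightarrow> 'a)) \<Rightarrow> 'i set set" where
  "communication_complex B J I f =
    insert {} {S. S \<subseteq> I \<and> S \<noteq> {} \<and> (\<Inter>i\<in>S. input_window B J f i) \<noteq> {}}"

text \<open>HOL cannot quantify existentially over types, so the finite sets \<open>B\<close> and \<open>J\<close> are
  taken among sets of natural numbers. By \<open>generatesI\<close> below this is no restriction.\<close>

definition generates :: "'i set \<Rightarrow> 'a set \<Rightarrow> 'i set set \<Rightarrow> ('i \<Rightarrow> 'a) set \<Rightarrow> bool" where
  "generates I A K L \<longleftrightarrow>
    (\<exists>(B :: nat set) (J :: nat set) f. finite B \<and> finite J \<and>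
      f \<in> (J \<rightarrow>\<^sub>E B) \<rightarrow> (I \<rightarrow>\<^sub>E A) \<and> f ` (J \<rightarrow>\<^sub>E B) = L \<and>
      communication_complex B J I f \<subseteq> K)"

definition minimal_complex_generating ::
  "'i set \<Rightarrow> 'a set \<Rightarrow> 'i set set \<Rightarrow> ('i \<Rightarrow> 'a) set \<Rightarrow> bool" where
  "minimal_complex_generating I A K L \<longleftrightarrow>
    simplicial_complex I K \<and> generates I A K L \<and>
    (\<forall>K'. simplicial_complex I K' \<and> K' \<subset> K \<longrightarrow> \<not> generates I A K' L)"

definition unique_one :: "nat \<Rightarrow> (nat \<Rightarrow> nat) set" where
  "unique_one n = {u \<in> {0..<n} \<rightarrow>\<^sub>E {0, 1}. \<exists>!i. i \<in> {0..<n} \<and> u i = 1}"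

lemma determines_subset: "determines B J f i W \<Longrightarrow> W \<subseteq> J"
  unfolding determines_def by (rule conjunct1)

lemma determinesD:
  assumes "determines B J f i W" "x \<in> J \<rightarrow>\<^sub>E B" "y \<in> J \<rightarrow>\<^sub>E B" "restrict x W = restrict y W"
  shows "f x i = f y i"
  using assms(1)[unfolded determines_def, THEN conjunct2, rule_format, OF assms(2-)] .

lemma determines_Int:
  assumes "determines B J f i V" "determines B J f i W"
  shows "determines B J f i (V \<inter> W)"
  unfolding determines_def
proof (intro conjI ballI impI)
  show "V \<inter> W \<subseteq> J" using determines_subset[OF assms(1)] by blast
next
  fix x y assume x: "x \<in> J \<rightarrow>\<^sub>E B" and y: "y \<in> J \<rightarrow>\<^sub>E B"
    and eq: "restrict x (V \<inter> W) = restrict y (V \<inter> W)"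
  define z where "z = (\<lambda>j. if j \<in> V then x j else y j)"
  have VJ: "V \<subseteq> J" by (rule determines_subset[OF assms(1)])
  have z: "z \<in> J \<rightarrow>\<^sub>E B"
    using x y VJ by (auto simp: z_def PiE_iff extensional_def)
  have xy: "x j = y j" if "j \<in> V" "j \<in> W" for j
    using fun_cong[OF eq, of j] that by simp
  have "restrict x V = restrict z V" by (auto simp: z_def restrict_def)
  moreover have "restrict z W = restrict y W"
    using xy by (auto simp: z_def restrict_def)
  ultimately show "f x i = f y i"
    using determinesD[OF assms(1) x z] determinesD[OF assms(2) z y] by simp
qed

lemma input_window_least:
  assumes "finite J"
  shows "determines B J f i (input_window B J f i)"
    and "determines B J f i W \<Longrightarrow> input_window B J f i \<subseteq> W"
proof -
  have J: "determines B J f i J"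
    unfolding determines_def
  proof (intro conjI ballI impI)
    fix x y assume "x \<in> J \<rightarrow>\<^sub>E B" "y \<in> J \<rightarrow>\<^sub>E B" "restrict x J = restrict y J"
    then have "x = y" by (simp only: PiE_restrict)
    then show "f x i = f y i" by simp
  qed simp
  define F where "F = {W. determines B J f i W}"
  have "F \<subseteq> Pow J" using determines_subset by (force simp: F_def)
  then have fin: "finite F" using assms finite_subset by blast
  have "G \<noteq> {} \<Longrightarrow> G \<subseteq> F \<Longrightarrow> determines B J f i (\<Inter>G)" if "finite G" for G
    using that
  proof (induction G rule: finite_induct)
    case (insert V G)
    then have "determines B J f i V" by (simp add: F_def)
    then show ?case
      using insert by (cases "G = {}") (simp_all add: determines_Int)
  qed simp
  then have d: "determines B J f i (\<Inter>F)" using fin J by (metis F_def empty_iff mem_Collect_eq order_refl)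
  have l: "\<Inter>F \<subseteq> W" if "determines B J f i W" for W using that by (auto simp: F_def)
  have "input_window B J f i = \<Inter>F"
    unfolding input_window_def by (rule Least_equality) (fact d, fact l)
  then show "determines B J f i (input_window B J f i)"
    and "determines B J f i W \<Longrightarrow> input_window B J f i \<subseteq> W"
    using d l by simp_all
qed

lemma generatesI:
  fixes B :: "'b set" and J :: "'j set"
  assumes "finite B" "finite J" and f: "f \<in> (J \<rightarrow>\<^sub>E B) \<rightarrow> (I \<rightarrow>\<^sub>E A)"
    and L: "f ` (J \<rightarrow>\<^sub>E B) = L" and K: "communication_complex B J I f \<subseteq> K"
  shows "generates I A K L"
proof -
  obtain h :: "'b \<Rightarrow> nat" where h: "inj_on h B"
    using finite_imp_inj_to_nat_seg[OF \<open>finite B\<close>] by blast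
  obtain g :: "'j \<Rightarrow> nat" where g: "inj_on g J"
    using finite_imp_inj_to_nat_seg[OF \<open>finite J\<close>] by blast
  define c where "c = (\<lambda>x. restrict (\<lambda>j. inv_into B h (x (g j))) J)"
  define d where "d = (\<lambda>x. restrict (\<lambda>k. h (x (inv_into J g k))) (g ` J))"
  let ?P = "J \<rightarrow>\<^sub>E B" and ?Q = "g ` J \<rightarrow>\<^sub>E h ` B"
  have c: "c x \<in> ?P" if "x \<in> ?Q" for x
    unfolding c_def using PiE_mem[OF that]
    by (intro restrict_PiE_iff[THEN iffD2] ballI inv_into_into) blast
  have d: "d x \<in> ?Q" if "x \<in> ?P" for x
    using that g by (auto simp: d_def PiE_iff)
  have cd: "c (d x) = x" if x: "x \<in> ?P" for x
  proof
    fix j show "c (d x) j = x j"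
    proof (cases "j \<in> J")
      case True
      then show ?thesis
        using PiE_mem[OF x] g h by (simp add: c_def d_def inv_into_f_f)
    next
      case False
      then show ?thesis using PiE_arb[OF x] by (simp add: c_def)
    qed
  qed
  have cQ: "c ` ?Q = ?P"
  proof
    show "c ` ?Q \<subseteq> ?P" using c by blast
    show "?P \<subseteq> c ` ?Q"
    proof
      fix x assume "x \<in> ?P"
      then show "x \<in> c ` ?Q" using d cd by (intro image_eqI[of _ _ "d x"]) simp_all
    qed
  qed
  have "determines (h ` B) (g ` J) (f \<circ> c) i (g ` W)"
    if W: "determines B J f i W" for i W
    unfolding determines_def
  proof (intro conjI ballI impI)
    show "g ` W \<subseteq> g ` J" using determines_subset[OF W] by blast
  next
    fix x y assume x: "x \<in> ?Q" and y: "y \<in> ?Q"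
      and eq: "restrict x (g ` W) = restrict y (g ` W)"
    have xy: "x (g j) = y (g j)" if "j \<in> W" for j
      using fun_cong[OF eq, of "g j"] that by simp
    have "restrict (c x) W = restrict (c y) W"
      by (rule restrict_ext) (simp add: c_def restrict_def xy)
    then show "(f \<circ> c) x i = (f \<circ> c) y i"
      using determinesD[OF W c[OF x] c[OF y]] by simp
  qed
  then have sub: "input_window (h ` B) (g ` J) (f \<circ> c) i \<subseteq> g ` input_window B J f i" for i
    by (intro input_window_least(2) finite_imageI \<open>finite J\<close>)
      (simp add: input_window_least(1) \<open>finite J\<close>)
  have win: "input_window B J f i \<subseteq> J" for i
    by (rule determines_subset[OF input_window_least(1)[OF \<open>finite J\<close>]])
  have "communication_complex (h ` B) (g ` J) I (f \<circ> c) \<subseteq> communication_complex B J I f"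
  proof
    fix S assume S: "S \<in> communication_complex (h ` B) (g ` J) I (f \<circ> c)"
    show "S \<in> communication_complex B J I f"
    proof (cases "S = {}")
      case False
      with S have SI: "S \<subseteq> I"
        and "(\<Inter>i\<in>S. input_window (h ` B) (g ` J) (f \<circ> c) i) \<noteq> {}"
        by (simp_all add: communication_complex_def)
      then obtain k where "\<forall>i \<in> S. k \<in> input_window (h ` B) (g ` J) (f \<circ> c) i"
        by blast
      then have k: "k \<in> g ` input_window B J f i" if "i \<in> S" for i
        using sub that by blast
      from False k win obtain j where j: "j \<in> J" "k = g j" by blast
      have "j \<in> input_window B J f i" if "i \<in> S" for i
        using k[OF that] j win[of i] g by (auto simp: inj_on_def)
      then show ?thesis using SI False by (auto simp: communication_complex_def)
    qed (simp add: communication_complex_def)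
  qed
  moreover have "(f \<circ> c) ` ?Q = L" using cQ L by (simp only: image_comp[symmetric])
  moreover have "f \<circ> c \<in> ?Q \<rightarrow> (I \<rightarrow>\<^sub>E A)" using f c by (simp add: Pi_iff)
  ultimately show ?thesis
    unfolding generates_def using K
    using finite_imageI[OF \<open>finite B\<close>, of h] finite_imageI[OF \<open>finite J\<close>, of g]
    by (metis subset_trans)
qed

text \<open>A finite complex is determined by its maximal simplices, and any antichain of subsets
  of \<open>I\<close> (other than the empty family) arises as the family of maximal simplices.\<close>

lemma complex_eq_facets:
  assumes "finite I" "simplicial_complex I K"
  shows "K = {S. \<exists>F \<in> maximal_simplices K. S \<subseteq> F}"
proof -
  have fin: "finite K" using assms finite_subset[of K "Pow I"] by (auto simp: simplicial_complex_def)
  have "\<exists>F \<in> maximal_simplices K. S \<subseteq> F" if S: "S \<in> K" for S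
  proof -
    obtain F where "F \<in> K" "S \<subseteq> F" "\<And>T. T \<in> K \<Longrightarrow> F \<subseteq> T \<Longrightarrow> F = T"
      using finite_has_maximal2[OF fin S] by metis
    then show ?thesis unfolding maximal_simplices_def by blast
  qed
  moreover have "S \<in> K" if "F \<in> maximal_simplices K" "S \<subseteq> F" for S F
    using that assms(2) unfolding maximal_simplices_def simplicial_complex_def by blast
  ultimately show ?thesis by blast
qed

lemma complex_of_facets:
  assumes "\<F> \<subseteq> Pow I" "\<F> \<noteq> {}" "\<And>F G. F \<in> \<F> \<Longrightarrow> G \<in> \<F> \<Longrightarrow> F \<subseteq> G \<Longrightarrow> F = G"
  shows "simplicial_complex I {S. \<exists>F \<in> \<F>. S \<subseteq> F}"
    and "maximal_simplices {S. \<exists>F \<in> \<F>. S \<subseteq> F} = \<F>"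
proof -
  show "simplicial_complex I {S. \<exists>F \<in> \<F>. S \<subseteq> F}"
    using assms(1,2) unfolding simplicial_complex_def by blast
  show "maximal_simplices {S. \<exists>F \<in> \<F>. S \<subseteq> F} = \<F>"
  proof
    show "\<F> \<subseteq> maximal_simplices {S. \<exists>F \<in> \<F>. S \<subseteq> F}"
      using assms(3) by (fastforce simp: maximal_simplices_def)
    show "maximal_simplices {S. \<exists>F \<in> \<F>. S \<subseteq> F} \<subseteq> \<F>"
      unfolding maximal_simplices_def by blast
  qed
qed

end

theory Submission imports Defs begin

text \<open>Generation: every pair of sites other than \<open>a\<close> shares an input naming a site; such a site
  outputs 1 iff all its inputs name it, and \<open>a\<close>, which reads everything, outputs 1 iff no other
  site does.

  Minimality: let \<open>b \<noteq> c\<close> and suppose that no input is read by \<open>b\<close>, \<open>c\<close> and a third site.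
  Split an input into the part \<open>y\<close> read by both \<open>b\<close> and \<open>c\<close>, the part \<open>p\<close> read by \<open>b\<close> only,
  and the rest \<open>q\<close>, so that \<open>f\<^sub>b = f\<^sub>b(y, p)\<close> and \<open>f\<^sub>c = f\<^sub>c(y, q)\<close>. As the other sites do not
  read \<open>y\<close>, the sum \<open>f\<^sub>b(y, p) + f\<^sub>c(y, q) \<le> 1\<close> does not depend on \<open>y\<close>. Choosing \<open>y\<close> with
  \<open>f\<^sub>b(y, _) = 1\<close> somewhere gives \<open>f\<^sub>c(y, _) = 0\<close>, so the sum depends on \<open>p\<close> only;
  symmetrically it depends on \<open>q\<close> only. Hence it is constant, although it takes both values.
  So \<open>b\<close>, \<open>c\<close> and some third site share an input; within \<open>K\<^sub>a\<close> that site can only be \<open>a\<close>.\<close>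

lemma input_window_cong:
  assumes "finite J" "x \<in> J \<rightarrow>\<^sub>E B" "y \<in> J \<rightarrow>\<^sub>E B"
    and "\<And>j. j \<in> input_window B J f i \<Longrightarrow> x j = y j"
  shows "f x i = f y i"
  using determinesD[OF input_window_least(1)[OF assms(1)] assms(2,3)] assms(4)
  by (metis restrict_ext)

lemma unique_one_indicator:
  assumes "i < n"
  shows "restrict (\<lambda>k. if k = i then 1 else 0) {0..<n} \<in> unique_one n"
  using assms by (auto simp: unique_one_def)

lemma unique_one_eqI:
  assumes "u \<in> unique_one n" "v \<in> unique_one n" "i < n" "u i = 1" "v i = 1"
  shows "u = v"
proof -
  have "w = restrict (\<lambda>k. if k = i then 1 else 0) {0..<n}"
    if w: "w \<in> unique_one n" and "w i = 1" for w
  proof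
    fix k
    have PiE: "w \<in> {0..<n} \<rightarrow>\<^sub>E {0, 1}" using w unfolding unique_one_def by blast
    have one: "\<exists>!k. k \<in> {0..<n} \<and> w k = 1" using w unfolding unique_one_def by blast
    consider "k = i" | "k < n" "k \<noteq> i" | "\<not> k < n" by blast
    then show "w k = restrict (\<lambda>k. if k = i then 1 else 0) {0..<n} k"
    proof cases
      case 1
      then show ?thesis using \<open>w i = 1\<close> \<open>i < n\<close> by simp
    next
      case 2
      then have "w k \<noteq> 1"
        using one \<open>w i = 1\<close> \<open>i < n\<close> by (metis atLeastLessThan_iff zero_le)
      then show ?thesis using PiE_mem[OF PiE, of k] 2 by simp
    next
      case 3
      then show ?thesis using PiE_arb[OF PiE, of k] by simp
    qed
  qed
  from this[OF assms(1,4)] this[OF assms(2,5)] show ?thesis by (rule trans[OF _ sym])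
qed

text \<open>This constrains every complex generating \<open>unique_one n\<close>, not only those
  inside \<open>K\<^sub>a\<close>: any two sites must lie in a simplex with some third one.\<close>

lemma unique_one_common_input:
  assumes "finite J" and im: "f ` (J \<rightarrow>\<^sub>E B) = unique_one n"
    and n: "n \<ge> 3" and b: "b < n" and c: "c < n" and "b \<noteq> c"
  shows "\<exists>d<n. d \<noteq> b \<and> d \<noteq> c \<and>
    input_window B J f b \<inter> input_window B J f c \<inter> input_window B J f d \<noteq> {}"
proof (rule ccontr)
  let ?W = "input_window B J f" and ?P = "J \<rightarrow>\<^sub>E B"
  assume "\<not> ?thesis"
  then have disj: "j \<notin> ?W d" if "d < n" "d \<noteq> b" "d \<noteq> c" "j \<in> ?W b" "j \<in> ?W c" for d j
    using that by blast
  have ex1: "\<exists>!i. i < n \<and> f x i = 1" if "x \<in> ?P" for x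
  proof -
    have "f x \<in> unique_one n" unfolding im[symmetric] using that by (rule imageI)
    then show ?thesis by (simp add: unique_one_def)
  qed
  have site: "\<exists>x\<in>?P. f x i = 1" if i: "i < n" for i
  proof -
    from unique_one_indicator[OF i] obtain x
      where "x \<in> ?P" "f x = restrict (\<lambda>k. if k = i then 1 else 0) {0..<n}"
      unfolding im[symmetric] by (rule imageE) simp
    then show ?thesis using i by (intro bexI[of _ x]) simp_all
  qed
  \<comment> \<open>Here \<open>y\<close>, \<open>p\<close> and \<open>q\<close> are full inputs,
    each contributing one part, so that parts can be exchanged one at a time and
    \<open>mix x x x\<close> is \<open>x\<close> itself.\<close>
  define mix where "mix y p q = (\<lambda>j. if j \<in> ?W b then if j \<in> ?W c then y j else p j else q j)"
    for y p q :: "'a \<Rightarrow> 'b"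
  have mix_in: "mix y p q \<in> ?P" if "y \<in> ?P" "p \<in> ?P" "q \<in> ?P" for y p q
    using that by (auto simp: mix_def PiE_iff extensional_def)
  have mix_b: "f (mix y p q) b = f (mix y p q') b"
    if "y \<in> ?P" "p \<in> ?P" "q \<in> ?P" "q' \<in> ?P" for y p q q'
    by (rule input_window_cong[where f = f and B = B and i = b, OF \<open>finite J\<close>])
      (use that mix_in in \<open>simp_all add: mix_def\<close>)
  have mix_c: "f (mix y p q) c = f (mix y p' q) c"
    if "y \<in> ?P" "p \<in> ?P" "q \<in> ?P" "p' \<in> ?P" for y p q p'
    by (rule input_window_cong[where f = f and B = B and i = c, OF \<open>finite J\<close>])
      (use that mix_in in \<open>simp_all add: mix_def\<close>)
  have mix_d: "f (mix y p q) d = f (mix y' p q) d"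
    if "y \<in> ?P" "p \<in> ?P" "q \<in> ?P" "y' \<in> ?P" "d < n" "d \<noteq> b" "d \<noteq> c" for y p q y' d
    by (rule input_window_cong[where f = f and B = B and i = d, OF \<open>finite J\<close>])
      (use that mix_in disj in \<open>auto simp: mix_def\<close>)
  have mix_self: "mix x x x = x" for x
    by (auto simp: mix_def)
  \<comment> \<open>On \<open>?P\<close>, \<open>G x\<close> says that \<open>f x b + f x c\<close>
    is 1. \<open>G_iff\<close> expresses this through the other sites, which do not read the
    \<open>y\<close> part; hence \<open>G_mix\<close>.\<close>
  define G where "G x \<longleftrightarrow> f x b = 1 \<or> f x c = 1" for x
  have G_iff: "G x \<longleftrightarrow> (\<forall>d<n. d \<noteq> b \<longrightarrow> d \<noteq> c \<longrightarrow> f x d \<noteq> 1)" if "x \<in> ?P" for x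
    using ex1[OF that] b c unfolding G_def by metis
  have G_mix: "G (mix y p q) \<longleftrightarrow> G (mix y' p q)"
    if "y \<in> ?P" "p \<in> ?P" "q \<in> ?P" "y' \<in> ?P" for y p q y'
    using that mix_d[of y p q y'] by (simp add: G_iff mix_in)
  have not_both: "\<not> (f x b = 1 \<and> f x c = 1)" if "x \<in> ?P" for x
    using ex1[OF that] b c \<open>b \<noteq> c\<close> by blast
  \<comment> \<open>A third site exists because \<open>n \<ge> 3\<close>; an input \<open>w\<close>
    at which it outputs 1 makes \<open>G\<close> fail.\<close>
  obtain d where d: "d < n" "d \<noteq> b" "d \<noteq> c"
  proof -
    have "card {b, c} < card {0..<n}" using n by (simp add: \<open>b \<noteq> c\<close>)
    then have "\<not> {0..<n} \<subseteq> {b, c}" by (metis card_mono finite.emptyI finite.insertI not_le)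
    then obtain d where "d \<in> {0..<n}" "d \<notin> {b, c}" by blast
    then show ?thesis by (intro that[of d]) simp_all
  qed
  obtain u v w where P: "u \<in> ?P" "v \<in> ?P" "w \<in> ?P"
    and uvw: "f u b = 1" "f v c = 1" "f w d = 1"
    using site b c d by meson
  have Gu: "G (mix u u q)" if "q \<in> ?P" for q
    using mix_b[of u u q u] P that uvw mix_self[of u] by (simp add: G_def)
  have Bv: "f (mix v p q) b \<noteq> 1" if "p \<in> ?P" "q \<in> ?P" for p q
    using not_both[OF mix_in[of v p v]] mix_b[of v p q v] mix_c[of v p v v] P that uvw
      mix_self[of v] by auto
  \<comment> \<open>Instead of proving both independence claims, the parts of \<open>u\<close>,
    where \<open>G\<close> holds, are turned into those of \<open>w\<close>. \<open>Gu\<close>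
    allows \<open>w\<close> as third part; \<open>v\<close> as first part silences \<open>b\<close>
    by \<open>Bv\<close>, so \<open>c\<close> outputs 1; \<open>c\<close> does not see the second
    part become \<open>w\<close>; \<open>G_mix\<close> then restores the first part to
    \<open>w\<close>.\<close>
  have "f (mix v u w) c = 1"
    using Gu[of w] G_mix[of u u w v] Bv[of u w] P by (auto simp: G_def)
  then have "f (mix v w w) c = 1" using mix_c[of v u w w] P by simp
  then have "G (mix w w w)" using G_mix[of v w w w] P by (auto simp: G_def)
  then show False using G_iff[of w] P uvw d by (auto simp: mix_self)
qed

lemma generates_unique_one:
  assumes n: "n \<ge> 3" and a: "a < n"
    and K: "\<And>b c S. b \<in> {0..<n} - {a} \<Longrightarrow> c \<in> {0..<n} - {a} \<Longrightarrow> b \<noteq> c \<Longrightarrow> S \<subseteq> {a, b, c} \<Longrightarrow> S \<in> K"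
  shows "generates {0..<n} {0, 1} K (unique_one n)"
proof -
  define V where "V = {0..<n} - {a}"
  define J where "J = {{b, c} | b c. b \<in> V \<and> c \<in> V \<and> b \<noteq> c}"
  define wins where "wins x b \<longleftrightarrow> (\<forall>j\<in>J. b \<in> j \<longrightarrow> x j = b)" for x :: "nat set \<Rightarrow> nat" and b
  define f where "f x = restrict (\<lambda>i. if i = a then if \<exists>b\<in>V. wins x b then 0 else 1
    else if wins x i then 1 else 0 :: nat) {0..<n}" for x
  \<comment> \<open>Values range over all sites, not just the two members of the pair: if every
    input names \<open>a\<close>, no site of \<open>V\<close> wins. So a constant input realises
    each word.\<close>
  let ?P = "J \<rightarrow>\<^sub>E {0..<n}"
  have "J \<subseteq> Pow V" by (auto simp: J_def)
  then have finJ: "finite J" by (rule finite_subset) (simp add: V_def)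
  have wins_unique: "b = c" if "wins x b" "wins x c" "b \<in> V" "c \<in> V" for x b c
  proof (rule ccontr)
    assume "b \<noteq> c"
    then have "{b, c} \<in> J" using that by (auto simp: J_def)
    then have "x {b, c} = b" "x {b, c} = c" using that(1,2) by (auto simp: wins_def)
    then show False using \<open>b \<noteq> c\<close> by simp
  qed
  \<comment> \<open>A site lying in no pair would win vacuously; \<open>n \<ge> 3\<close> excludes
    this.\<close>
  have partner: "\<exists>c\<in>V. c \<noteq> b" if "b \<in> V" for b
  proof (rule ccontr)
    assume "\<not> ?thesis"
    then have "{0..<n} \<subseteq> {a, b}" by (auto simp: V_def)
    then have "card {0..<n} \<le> card {a, b}" by (rule card_mono[rotated]) simp
    also have "\<dots> \<le> 2" by (simp add: card_insert_if)
    finally show False using n by simp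
  qed
  have f_in: "f x \<in> unique_one n" for x
  proof -
    have "\<exists>!i. i < n \<and> f x i = 1"
    proof (cases "\<exists>b\<in>V. wins x b")
      case True
      then obtain b where "b \<in> V" "wins x b" by blast
      then show ?thesis
        using wins_unique by (intro ex1I[of _ b]) (auto simp: f_def V_def split: if_splits)
    next
      case False
      then show ?thesis
        using a by (intro ex1I[of _ a]) (auto simp: f_def V_def split: if_splits)
    qed
    then show ?thesis by (auto simp: unique_one_def f_def)
  qed
  have "u \<in> f ` ?P" if u: "u \<in> unique_one n" for u
  proof -
    obtain i where i: "i < n" "u i = 1" using u by (auto simp: unique_one_def)
    define x where "x = restrict (\<lambda>_. i) J"
    have wins_i: "b = i" if b: "b \<in> V" and win: "wins x b" for b
    proof -
      obtain c where "c \<in> V" "c \<noteq> b" using partner[OF b] by blast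
      then have "{b, c} \<in> J" using b by (auto simp: J_def)
      then show ?thesis using win by (force simp: wins_def x_def)
    qed
    have "wins x i" by (simp add: wins_def x_def)
    moreover have "\<not> wins x b" if "i = a" "b \<in> V" for b
      using wins_i[OF \<open>b \<in> V\<close>] that by (auto simp: V_def)
    ultimately have "f x i = 1"
      using i(1) by (simp add: f_def)
    then have "f x = u" by (rule unique_one_eqI[OF f_in u i(1) _ i(2)])
    moreover have "x \<in> ?P" using i by (simp add: x_def)
    ultimately show ?thesis by blast
  qed
  then have im: "f ` ?P = unique_one n" using f_in by blast
  \<comment> \<open>The window of \<open>a\<close> may be arbitrary, as \<open>a\<close> lies in
    every facet \<open>{a, b, c}\<close>.\<close>
  have det: "determines {0..<n} J f i {j \<in> J. i \<in> j}" if "i \<noteq> a" for i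
    unfolding determines_def
  proof (intro conjI ballI impI)
    fix x y :: "nat set \<Rightarrow> nat" assume eq: "restrict x {j \<in> J. i \<in> j} = restrict y {j \<in> J. i \<in> j}"
    have "x j = y j" if "j \<in> J" "i \<in> j" for j
      using fun_cong[OF eq, of j] that by simp
    then have "wins x i = wins y i" by (auto simp: wins_def)
    then show "f x i = f y i" using that by (simp add: f_def)
  qed blast
  have win: "j \<in> J \<and> (i \<noteq> a \<longrightarrow> i \<in> j)" if j: "j \<in> input_window {0..<n} J f i" for i j
  proof
    show "j \<in> J" using j determines_subset[OF input_window_least(1)[OF finJ]] by (rule rev_subsetD)
    show "i \<noteq> a \<longrightarrow> i \<in> j" using input_window_least(2)[OF finJ det[of i]] j by blast
  qed
  have "communication_complex {0..<n} J {0..<n} f \<subseteq> K"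
  proof
    fix S assume S: "S \<in> communication_complex {0..<n} J {0..<n} f"
    have "\<exists>j\<in>J. \<forall>i\<in>S. i \<noteq> a \<longrightarrow> i \<in> j"
    proof (cases "S = {}")
      case True
      \<comment> \<open>The empty simplex comes with no common input, so some pair in
        \<open>J\<close> is exhibited by hand.\<close>
      define b where "b = (if a = 0 then 1 else 0 :: nat)"
      have b: "b \<in> V" using n by (simp add: V_def b_def)
      then obtain c where "c \<in> V" "c \<noteq> b" using partner by blast
      then have "{b, c} \<in> J" using b by (auto simp: J_def)
      then show ?thesis using True by blast
    next
      case False
      then have "(\<Inter>i\<in>S. input_window {0..<n} J f i) \<noteq> {}"
        using S by (simp add: communication_complex_def)
      then obtain j where "\<forall>i\<in>S. j \<in> input_window {0..<n} J f i" by blast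
      then show ?thesis using win False by blast
    qed
    then obtain b c where "b \<in> V" "c \<in> V" "b \<noteq> c" "\<forall>i\<in>S. i \<noteq> a \<longrightarrow> i \<in> {b, c}"
      by (auto simp: J_def)
    then show "S \<in> K" unfolding V_def by (intro K[of b c]) auto
  qed
  moreover have "f \<in> ?P \<rightarrow> ({0..<n} \<rightarrow>\<^sub>E {0, 1})" using f_in by (auto simp: unique_one_def)
  ultimately show ?thesis using im finJ by (intro generatesI[of "{0..<n}" J f]) auto
qed

theorem proposition4p2:
  fixes n a :: nat and K\<^sub>a :: "nat set set"
  assumes "n \<ge> 3" and "a \<in> {0..<n}"
    and "simplicial_complex {0..<n} K\<^sub>a"
    and "maximal_simplices K\<^sub>a =
      {{a, b, c} | b c. b \<in> {0..<n} - {a} \<and> c \<in> {0..<n} - {a} \<and> b \<noteq> c}"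
  shows "minimal_complex_generating {0..<n} {0, 1} K\<^sub>a (unique_one n)"
proof -
  let ?V = "{0..<n} - {a}"
  have K: "S \<in> K\<^sub>a \<longleftrightarrow> (\<exists>b\<in>?V. \<exists>c\<in>?V. b \<noteq> c \<and> S \<subseteq> {a, b, c})" for S
    by (subst complex_eq_facets[OF finite_atLeastLessThan assms(3)], subst assms(4)) blast
  have "K\<^sub>a \<subseteq> K'"
    if K': "simplicial_complex {0..<n} K'" "K' \<subseteq> K\<^sub>a"
      and gen: "generates {0..<n} {0, 1} K' (unique_one n)" for K'
  proof
    fix S assume "S \<in> K\<^sub>a"
    then obtain b c where bc: "b \<in> ?V" "c \<in> ?V" "b \<noteq> c" and S: "S \<subseteq> {a, b, c}"
      using K by blast
    obtain B J :: "nat set" and f where "finite J"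
      and "f ` (J \<rightarrow>\<^sub>E B) = unique_one n"
      and comm: "communication_complex B J {0..<n} f \<subseteq> K'"
      using gen unfolding generates_def by blast
    then obtain d where d: "d < n" "d \<noteq> b" "d \<noteq> c"
      and ne: "input_window B J f b \<inter> input_window B J f c \<inter> input_window B J f d \<noteq> {}"
      using unique_one_common_input[of J f B n b c] assms(1) bc by auto
    have "{b, c, d} \<in> communication_complex B J {0..<n} f"
      using ne d bc by (auto simp: communication_complex_def)
    then have bcd: "{b, c, d} \<in> K'" using comm by blast
    then obtain b' c' where "{b, c, d} \<subseteq> {a, b', c'}" using K'(2) K by blast
    \<comment> \<open>Three distinct sites fill the facet \<open>{a, b', c'}\<close>, so one of them
      is \<open>a\<close>, and \<open>b\<close> and \<open>c\<close> are not.\<close>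
    then have "d = a" using bc d by auto
    then have "S \<subseteq> {b, c, d}" using S by blast
    then show "S \<in> K'" using bcd K'(1) unfolding simplicial_complex_def by blast
  qed
  moreover have "generates {0..<n} {0, 1} K\<^sub>a (unique_one n)"
    by (rule generates_unique_one[of n a]) (use assms(1,2) in \<open>simp_all only: K atLeastLessThan_iff, blast\<close>)
  ultimately show ?thesis
    using assms(3) unfolding minimal_complex_generating_def by blast
qed

end
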